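(* Fix $n$ and a simple graph $S$. Let $G$ be a bridge sum of $S$ with the complete graph $K$ on $n$ vertices, and let $\sigma$ be any labeling of $G$. Then the length of the orbit of toric promotion containing the state $(\sigma,i)$ depends only on $n$, $S$, and $\phi$, the restriction of $\sigma$ to (the vertices of) $S$.
   Context: Toric promotion. Let $G=(V,E)$ be a simple graph (undirected, unweighted, no self-loops, no multiple edges) on $N$ vertices. A labeling of $G$ is a bijection $\sigma:V\to\mathbb{Z}/N\mathbb{Z}=\{1,\dots,N\}$ (addition modulo $N$). A state is a pair $(\sigma,i)$ with $\sigma$ a labeling of $G$ and $i\in\mathbb{Z}/N\mathbb{Z}$; $\Omega_G$ is the set of all states. Toric promotion is the map $\mathrm{TPro}:\Omega_G\to\Omega_G$ given by $\mathrm{TPro}(\sigma,i)=(\sigma,i+1)$ if $\{\sigma^{-1}(i),\sigma^{-1}(i+1)\}\in E$, and $\mathrm{TPro}(\sigma,i)=((i,i+1)\circ\sigma,\,i+1)$ if $\{\sigma^{-1}(i),\sigma^{-1}(i+1)\}\notin E$, where $(i,i+1)$ is the involution swapping the labels $i$ and $i+1$. It is a bijection of $\Omega_G$. The length of the orbit containing $(\sigma,i)$ is the minimum number (at least one) of iterations of $\mathrm{TPro}$ required to get from $(\sigma,i)$ back to $(\sigma,i)$. Bridge sum. For graphs $G_1=(V_1,E_1)$, $G_2=(V_2,E_2)$ (with disjoint vertex sets) and vertices $v_1\in V_1$, $v_2\in V_2$, the bridge sum of $G_1$ and $G_2$ at $v_1$ and $v_2$ is the graph with vertex set $V_1\cup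 V_2$ and edge set $E_1\cup E_2\cup\{\{v_1,v_2\}\}$. "A bridge sum" of two graphs means a bridge sum at any two vertices, one from each graph.
   Formalization: The length may also depend on i and on the bridge's endpoint v in S, both fixed in advance. Literally the claim fails: for S two isolated vertices a,b labeled 1,2 and n=1, a bridge at a gives length 12 for i=1 and 6 for i=2; a bridge at b gives 6 for i=1. *)

theory Defs
  imports "HOL-Combinatorics.Cycles"
begin

text \<open>A graph is a pair of a vertex set and a set of edges, each edge being an unordered pair.\<close>

type_synonym 'a graph = "'a set \<times> 'a set set"

abbreviation verts :: "'a graph \<Rightarrow> 'a set" where
  "verts G \<equiv> fst G"

abbreviation edges :: "'a graph \<Rightarrow> 'a set set" where
  "edges G \<equiv> snd G"

definition simple_graph :: "'a graph \<Rightarrow> bool" where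
  "simple_graph G \<longleftrightarrow> finite (verts G) \<and> (\<forall>e \<in> edges G. e \<subseteq> verts G \<and> card e = 2)"

definition complete_graph :: "nat \<Rightarrow> 'a graph \<Rightarrow> bool" where
  "complete_graph n G \<longleftrightarrow> finite (verts G) \<and> card (verts G) = n \<and>
     edges G = {e. e \<subseteq> verts G \<and> card e = 2}"

text \<open>The two graphs are meant to have disjoint vertex sets; this is assumed where the
  construction is used.\<close>

definition bridge_sum :: "'a graph \<Rightarrow> 'a \<Rightarrow> 'a graph \<Rightarrow> 'a \<Rightarrow> 'a graph" where
  "bridge_sum G1 v1 G2 v2 =
     (verts G1 \<union> verts G2, edges G1 \<union> edges G2 \<union> {{v1, v2}})"

text \<open>The residues modulo the number \<open>N\<close> of vertices are represented by \<open>1, \<dots>, N\<close>, so that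
  \<open>i + 1\<close> modulo \<open>N\<close> is \<open>i mod N + 1\<close>.\<close>

definition labels :: "'a graph \<Rightarrow> nat set" where
  "labels G = {1..card (verts G)}"

definition next_label :: "'a graph \<Rightarrow> nat \<Rightarrow> nat" where
  "next_label G i = i mod card (verts G) + 1"

text \<open>Labelings are extensional: the value outside the vertex set is fixed, so that equality of
  labelings, and hence of states, is equality on the vertices.\<close>

definition labelings :: "'a graph \<Rightarrow> ('a \<Rightarrow> nat) set" where
  "labelings G = {\<sigma> \<in> extensional (verts G). bij_betw \<sigma> (verts G) (labels G)}"

definition states :: "'a graph \<Rightarrow> (('a \<Rightarrow> nat) \<times> nat) set" where
  "states G = labelings G \<times> labels G"

fun tpro :: "'a graph \<Rightarrow> ('a \<Rightarrow> nat) \<times> nat \<Rightarrow> ('a \<Rightarrow> nat) \<times> nat" where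
  "tpro G (\<sigma>, i) =
     (if {inv_into (verts G) \<sigma> i, inv_into (verts G) \<sigma> (next_label G i)} \<in> edges G
      then (\<sigma>, next_label G i)
      else (compose (verts G) (transpose i (next_label G i)) \<sigma>, next_label G i))"

text \<open>\<^const>\<open>least_power\<close> is the least positive number of iterations that returns to the
  starting point.\<close>

definition orbit_length :: "'a graph \<Rightarrow> ('a \<Rightarrow> nat) \<times> nat \<Rightarrow> nat" where
  "orbit_length G s = least_power (tpro G) s"

end

theory Submission
  imports Defs
begin

text \<open>Read the vertices cyclically in the order of their labels, starting from the one that carries
  the stone, i.e. the label \<open>i\<close> of the state. On these words toric promotion sends \<open>a b r\<close> to \<open>b r a\<close>
  if \<open>a\<close> and \<open>b\<close> are adjacent and to \<open>a r b\<close> otherwise, and an orbit closes at the times divisible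
  by the number \<open>N\<close> of vertices at which the word recurs.

  Without the bridge \<open>v w\<close>, the vertices of the complete graph never change their cyclic order, and the
  pattern obtained by erasing their names evolves by itself. With the bridge, a stone that meets
  \<open>w\<close> while it is on \<open>v\<close> goes to the complete graph and comes back to \<open>v\<close> after exactly
  \<open>n (N - 1)\<close> further steps, with the word as if \<open>v\<close> had passed \<open>w\<close> in one step. Over a period, \<open>v\<close>
  passes each vertex of the complete graph equally often, so the number of these excursions,
  hence the total time, can be read off the pattern, wherever \<open>w\<close> is. If the stone starts on the
  complete graph, the pattern at its first arrival at \<open>v\<close> does not depend on \<open>w\<close> either.\<close>

subsection \<open>Toric promotion on words\<close>

fun toric_step :: "('b \<Rightarrow> 'b \<Rightarrow> bool) \<Rightarrow> 'b list \<Rightarrow> 'b list" where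
  "toric_step R (a # b # r) = (if R a b then b # r @ [a] else a # r @ [b])"
| "toric_step R xs = xs"

lemma length_toric_step [simp]: "length (toric_step R xs) = length xs"
  by (cases "(R, xs)" rule: toric_step.cases) auto

lemma mset_toric_step [simp]: "mset (toric_step R xs) = mset xs"
  by (cases "(R, xs)" rule: toric_step.cases) auto

lemma mset_toric_steps [simp]: "mset ((toric_step R ^^ k) xs) = mset xs"
  by (induction k) auto

lemma length_toric_steps [simp]: "length ((toric_step R ^^ k) xs) = length xs"
  by (metis mset_toric_steps size_mset)

lemma set_toric_steps [simp]: "set ((toric_step R ^^ k) xs) = set xs"
  by (metis mset_toric_steps set_mset_mset)

lemma distinct_toric_steps [simp]: "distinct ((toric_step R ^^ k) xs) = distinct xs"
  by (metis mset_toric_steps mset_eq_imp_distinct_iff)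

lemma toric_step_cases:
  obtains (short) "length xs < 2" | (long) a b r where "xs = a # b # r"
  by (cases xs; cases "tl xs") auto

lemma toric_step_short: "length xs < 2 \<Longrightarrow> toric_step R xs = xs"
  by (cases xs rule: toric_step_cases) (auto simp: less_2_cases_iff length_Suc_conv)

text \<open>If two words reached the same result by different branches, their leading pairs would be
  \<open>a, b\<close> and \<open>b, a\<close>, which the symmetry of \<open>R\<close>
  excludes.\<close>

lemma inj_toric_step:
  assumes "\<And>a b. R a b = R b a"
  shows "inj (toric_step R)"
proof (rule injI)
  fix xs ys assume eq: "toric_step R xs = toric_step R ys"
  then have len: "length xs = length ys" by (metis length_toric_step)
  show "xs = ys"
  proof (cases xs rule: toric_step_cases)
    case short
    then show ?thesis using eq len by (simp add: toric_step_short)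
  next
    case (long a b r)
    then obtain c d s where "ys = c # d # s"
      using len by (cases ys rule: toric_step_cases) auto
    then show ?thesis using eq long assms by (auto split: if_splits)
  qed
qed

text \<open>A word forgets the label at which it starts; that label recurs exactly at the multiples
  of the length, whence the divisibility.\<close>

definition return_times :: "('b \<Rightarrow> 'b \<Rightarrow> bool) \<Rightarrow> 'b list \<Rightarrow> nat set" where
  "return_times R xs = {t. 0 < t \<and> length xs dvd t \<and> (toric_step R ^^ t) xs = xs}"

text \<open>Injectivity lets \<open>k\<close> steps be cancelled, so a word may be replaced by any
  later one of its orbit.\<close>

lemma return_times_step:
  assumes "\<And>a b. R a b = R b a"
  shows "return_times R ((toric_step R ^^ k) xs) = return_times R xs"
proof -
  have "(toric_step R ^^ t) ((toric_step R ^^ k) xs) = (toric_step R ^^ k) xs \<longleftrightarrow>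
        (toric_step R ^^ t) xs = xs" for t
  proof -
    have "(toric_step R ^^ t) ((toric_step R ^^ k) xs)
        = (toric_step R ^^ k) ((toric_step R ^^ t) xs)"
      by (metis add.commute comp_apply funpow_add)
    then show ?thesis
      using inj_eq[OF inj_fn[OF inj_toric_step[of R, OF assms], of k]] by simp
  qed
  then show ?thesis by (simp add: return_times_def)
qed

lemma rotate_eq_self_iff:
  assumes "distinct xs" "xs \<noteq> []"
  shows "rotate m xs = xs \<longleftrightarrow> length xs dvd m"
proof
  assume "rotate m xs = xs"
  then have "xs ! (m mod length xs) = xs ! 0"
    using assms hd_rotate_conv_nth[of xs m] by (metis hd_conv_nth)
  then show "length xs dvd m"
    using assms by (simp add: nth_eq_iff_index_eq dvd_eq_mod_eq_0)
qed (simp add: dvd_eq_mod_eq_0)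

text \<open>Rotation lowers the position of \<open>w\<close> by one, except that position 0 wraps
  around to the last one; the \<open>of_bool\<close> term accounts for this.\<close>

lemma length_takeWhile_rotate1:
  assumes "distinct xs" "w \<in> set xs"
  shows "length xs * of_bool (hd xs = w) + length (takeWhile (\<lambda>a. a \<noteq> w) xs)
           = Suc (length (takeWhile (\<lambda>a. a \<noteq> w) (rotate1 xs)))"
proof (cases xs)
  case (Cons h t)
  show ?thesis
  proof (cases "h = w")
    case True
    have "takeWhile (\<lambda>a. a \<noteq> w) (t @ [w]) = t"
      using assms Cons True by (subst takeWhile_append2) auto
    then show ?thesis using Cons True by simp
  next
    case False
    then have "takeWhile (\<lambda>a. a \<noteq> w) (t @ [h]) = takeWhile (\<lambda>a. a \<noteq> w) t"
      using assms Cons by (intro takeWhile_append1) auto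
    then show ?thesis using Cons False by simp
  qed
qed (use assms in simp)

section \<open>Words on \<open>S\<close> and the complete graph, their patterns, and the motion
  without the bridge\<close>

locale bridge_words =
  fixes U :: "'a set" and E :: "'a set set" and v :: 'a
  assumes v_in_U: "v \<in> U"
begin

text \<open>Every element outside \<open>U\<close> counts as a vertex of the complete graph; \<open>base\<close> omits the
  bridge. Words list distinct vertices, so that \<open>base a a\<close> is irrelevant.\<close>

definition base :: "'a \<Rightarrow> 'a \<Rightarrow> bool" where
  "base a b \<longleftrightarrow> (if a \<in> U \<and> b \<in> U then {a, b} \<in> E else a \<notin> U \<and> b \<notin> U)"

definition full :: "'a \<Rightarrow> 'a \<Rightarrow> 'a \<Rightarrow> bool" where
  "full w a b \<longleftrightarrow> base a b \<or> {a, b} = {v, w}"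

definition pat :: "'a \<Rightarrow> 'a option" where
  "pat a = (if a \<in> U then Some a else None)"

fun padj :: "'a option \<Rightarrow> 'a option \<Rightarrow> bool" where
  "padj (Some a) (Some b) \<longleftrightarrow> {a, b} \<in> E"
| "padj None None \<longleftrightarrow> True"
| "padj _ _ \<longleftrightarrow> False"

abbreviation outer :: "'a list \<Rightarrow> 'a list" where
  "outer xs \<equiv> filter (\<lambda>a. a \<notin> U) xs"

abbreviation steps :: "nat \<Rightarrow> 'a list \<Rightarrow> 'a list" where
  "steps k \<equiv> toric_step base ^^ k"

abbreviation psteps :: "nat \<Rightarrow> 'a option list \<Rightarrow> 'a option list" where
  "psteps k \<equiv> toric_step padj ^^ k"

abbreviation fsteps :: "'a \<Rightarrow> nat \<Rightarrow> 'a list \<Rightarrow> 'a list" where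
  "fsteps w k \<equiv> toric_step (full w) ^^ k"

lemma full_sym: "full w a b = full w b a"
  by (auto simp: full_def base_def insert_commute)

lemma base_pat: "base a b = padj (pat a) (pat b)"
  by (simp add: base_def pat_def)

lemma pat_eq_None [simp]: "pat a = None \<longleftrightarrow> a \<notin> U" "None = pat a \<longleftrightarrow> a \<notin> U"
  by (auto simp: pat_def)

lemma pat_eq_Some [simp]: "pat a = Some b \<longleftrightarrow> a \<in> U \<and> a = b" "Some b = pat a \<longleftrightarrow> a \<in> U \<and> a = b"
  by (auto simp: pat_def)

lemma map_pat_steps: "map pat (steps k xs) = psteps k (map pat xs)"
proof (induction k)
  case (Suc k)
  have "map pat (toric_step base ys) = toric_step padj (map pat ys)" for ys
    by (cases "(base, ys)" rule: toric_step.cases) (auto simp: base_pat)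
  then show ?case using Suc by simp
qed auto

lemma word_eqI:
  assumes "map pat xs = map pat ys" "outer xs = outer ys"
  shows "xs = ys"
proof -
  have "length xs = length ys" using assms(1) by (metis length_map)
  then show ?thesis using assms
    by (induction xs ys rule: list_induct2) (auto simp: pat_def split: if_splits)
qed

text \<open>Records the rotation of \<open>outer\<close> in one bridgeless step: a
  \<open>None\<close> in second place is either passed by a stone on \<open>U\<close> or takes the
  stone from another complete-graph vertex, and both times the front entry of \<open>outer\<close>
  goes to the back.\<close>

fun turn :: "'a option list \<Rightarrow> nat" where
  "turn (_ # None # _) = 1"
| "turn _ = 0"

definition turns :: "'a option list \<Rightarrow> nat \<Rightarrow> nat" where
  "turns P k = (\<Sum>j<k. turn (psteps j P))"

lemma outer_steps: "outer (steps k xs) = rotate (turns (map pat xs) k) (outer xs)"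
proof (induction k)
  case (Suc k)
  have *: "outer (toric_step base ys) = rotate (turn (map pat ys)) (outer ys)" for ys
  proof (cases "(base, ys)" rule: toric_step.cases)
    case (1 R a b r)
    then show ?thesis
      by (cases "a \<in> U"; cases "b \<in> U") (auto simp: base_def pat_def)
  qed auto
  have "outer (steps (Suc k) xs) = rotate (turn (map pat (steps k xs))) (outer (steps k xs))"
    by (simp add: *)
  also have "\<dots> = rotate (turns (map pat xs) (Suc k)) (outer xs)"
    by (simp add: Suc rotate_rotate turns_def map_pat_steps add.commute)
  finally show ?case .
qed (simp add: turns_def)

lemma length_outer: "length (outer xs) = count_list (map pat xs) None"
  by (induction xs) auto

text \<open>As \<open>outer\<close> only rotates, its names recur when the total rotation is a
  multiple of its length. So recurrence without the bridge is a property of the pattern.\<close>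

lemma steps_return_iff:
  assumes "distinct xs" "outer xs \<noteq> []"
  shows "steps k xs = xs \<longleftrightarrow> psteps k (map pat xs) = map pat xs \<and>
           count_list (map pat xs) None dvd turns (map pat xs) k"
proof -
  have "steps k xs = xs \<longleftrightarrow> map pat (steps k xs) = map pat xs \<and> outer (steps k xs) = outer xs"
    using word_eqI by auto
  then show ?thesis
    using assms by (simp add: map_pat_steps outer_steps rotate_eq_self_iff length_outer[symmetric])
qed

text \<open>A \<open>None\<close> behind the stone takes it over and leaves a \<open>None\<close> at
  the back, while a \<open>Some\<close> is passed. The resulting pattern is a rotation behind the
  stone in both cases.\<close>

lemma psteps_None: "psteps k (None # P) = None # rotate k P"
proof (induction k)
  case (Suc k)
  have "toric_step padj (None # Q) = None # rotate1 Q" for Q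
  proof (cases Q)
    case (Cons q Q')
    then show ?thesis by (cases q) auto
  qed simp
  then show ?case using Suc by simp
qed simp

lemma turns_period:
  "turns (None # P) (length P) = count_list P None"
proof -
  have "turn (None # rotate k P) = of_bool (P ! k = None)" if "k < length P" for k
  proof -
    have "rotate k P \<noteq> []" using that by auto
    then obtain q Q where Q: "rotate k P = q # Q" by (cases "rotate k P") auto
    have "hd (rotate k P) = P ! k"
      using that by (subst hd_rotate_conv_nth) auto
    then show ?thesis using Q by (cases q) auto
  qed
  then have "turns (None # P) (length P) = (\<Sum>k<length P. of_bool (P ! k = None))"
    by (simp add: turns_def psteps_None)
  also have "\<dots> = count_list P None"
  proof (induction P rule: rev_induct)
    case (snoc x xs)
    have "(\<Sum>k<length xs. of_bool ((xs @ [x]) ! k = None)) = (\<Sum>k<length xs. of_bool (xs ! k = None) :: nat)"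
      by (rule sum.cong) (auto simp: nth_append)
    then show ?case using snoc by auto
  qed simp
  finally show ?thesis .
qed

text \<open>A round of \<open>length r\<close> steps restores the pattern and rotates
  \<open>outer\<close> by one less than its length, in effect one place backwards.\<close>

lemma steps_period:
  assumes "k \<notin> U"
  shows "map pat (steps (q * length r) (k # r)) = map pat (k # r)"
    and "outer (steps (q * length r) (k # r)) = rotate (q * length (outer r)) (outer (k # r))"
proof -
  show pt: "map pat (steps (q * length r) (k # r)) = map pat (k # r)" for q
    using assms by (simp add: map_pat_steps psteps_None pat_def)
  show "outer (steps (q * length r) (k # r)) = rotate (q * length (outer r)) (outer (k # r))"
  proof (induction q)
    case (Suc q)
    have "outer (steps (Suc q * length r) (k # r)) = outer (steps (length r) (steps (q * length r) (k # r)))"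
      by (simp add: funpow_add)
    also have "\<dots> = rotate (turns (map pat (k # r)) (length r)) (outer (steps (q * length r) (k # r)))"
      by (simp only: outer_steps pt)
    also have "turns (map pat (k # r)) (length r) = length (outer r)"
      using turns_period[of "map pat r"] assms by (simp add: length_outer pat_def)
    finally show ?case by (simp add: Suc rotate_rotate)
  qed simp
qed

subsection \<open>The stone on the complete graph\<close>

lemma steps_outer_head:
  assumes "k \<notin> U"
  obtains k' r' where "steps j (k # r) = k' # r'" "k' \<notin> U" "map pat r' = rotate j (map pat r)"
proof -
  have "map pat (steps j (k # r)) = None # rotate j (map pat r)"
    using assms by (simp add: map_pat_steps psteps_None pat_def)
  then show ?thesis using that by (auto simp: map_eq_Cons_conv)
qed

text \<open>With the stone on the complete graph, the bridge matters only if the stone is on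
  \<open>w\<close> and \<open>v\<close> comes next.\<close>

lemma fsteps_eq_steps:
  assumes "k \<notin> U" "\<And>i s. i < j \<Longrightarrow> steps i (k # r) \<noteq> w # v # s"
  shows "fsteps w j (k # r) = steps j (k # r)"
  using assms(2)
proof (induction j)
  case (Suc j)
  obtain k' r' where kr: "steps j (k # r) = k' # r'" "k' \<notin> U"
    using steps_outer_head[OF assms(1)] by metis
  have "toric_step (full w) (k' # r') = toric_step base (k' # r')"
  proof (cases r')
    case (Cons b s)
    then have "{k', b} \<noteq> {v, w}"
      using Suc.prems[of j s] kr v_in_U by (auto simp: doubleton_eq_iff)
    then show ?thesis using Cons by (simp add: full_def)
  qed simp
  then show ?case using Suc kr by simp
qed simp

text \<open>\<open>v\<close> occurs once, so a single residue of \<open>j\<close> brings it to the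
  front, always with the same pattern behind it.\<close>

lemma rotate_before_v:
  assumes "distinct (r1 @ v # r2)"
  shows "(\<exists>P. rotate j (map pat (r1 @ v # r2)) = Some v # P)
           \<longleftrightarrow> j mod length (r1 @ v # r2) = length r1"
    and "rotate j (map pat (r1 @ v # r2)) = Some v # P \<Longrightarrow> P = map pat (r2 @ r1)"
proof -
  let ?r = "r1 @ v # r2"
  have v: "rotate (length r1) (map pat ?r) = Some v # map pat (r2 @ r1)"
    using rotate_append[of "map pat r1" "map pat (v # r2)"] v_in_U by (simp add: pat_def)
  have hd: "hd (rotate j (map pat ?r)) = pat (?r ! (j mod length ?r))"
    by (subst hd_rotate_conv_nth) (auto simp: nth_map simp del: map_append)
  have if_v: "j mod length ?r = length r1" if "rotate j (map pat ?r) = Some v # P" for P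
  proof -
    have "?r ! (j mod length ?r) = ?r ! length r1"
      using hd that by simp
    then show ?thesis using assms by (subst (asm) nth_eq_iff_index_eq) auto
  qed
  then show "(\<exists>P. rotate j (map pat ?r) = Some v # P) \<longleftrightarrow> j mod length ?r = length r1"
    using v by (metis length_map rotate_conv_mod)
  show "P = map pat (r2 @ r1)" if "rotate j (map pat ?r) = Some v # P"
    using that v if_v[OF that] by (metis length_map list.inject rotate_conv_mod)
qed

lemma steps_before_v:
  assumes "k \<notin> U" "distinct (r1 @ v # r2)"
  shows "(\<exists>k' s. steps j (k # r1 @ v # r2) = k' # v # s)
           \<longleftrightarrow> j mod length (r1 @ v # r2) = length r1"
    and "steps j (k # r1 @ v # r2) = k' # v # s \<Longrightarrow> map pat s = map pat (r2 @ r1)"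
proof -
  obtain a r' where kr: "steps j (k # r1 @ v # r2) = a # r'"
      "map pat r' = rotate j (map pat (r1 @ v # r2))"
    using steps_outer_head[OF assms(1)] by metis
  have "(\<exists>s. r' = v # s) \<longleftrightarrow> (\<exists>P. map pat r' = Some v # P)"
    using v_in_U by (auto simp: map_eq_Cons_conv)
  then show "(\<exists>k' s. steps j (k # r1 @ v # r2) = k' # v # s)
           \<longleftrightarrow> j mod length (r1 @ v # r2) = length r1"
    unfolding rotate_before_v(1)[OF assms(2), symmetric] kr by simp
  show "map pat s = map pat (r2 @ r1)" if "steps j (k # r1 @ v # r2) = k' # v # s"
    using that rotate_before_v(2)[OF assms(2), of j "map pat s"] kr v_in_U by (auto simp: pat_def)
qed

lemma toric_step_base_v: "k \<notin> U \<Longrightarrow> toric_step base (k # v # s) = k # s @ [v]"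
  using v_in_U by (simp add: base_def)

lemma toric_step_full_v: "toric_step (full w) (w # v # s) = v # s @ [w]"
  by (simp add: full_def insert_commute)

text \<open>The return time of a stone handed over from \<open>v\<close> to \<open>w\<close>: in \<open>length r + 1\<close> steps the
  stone goes once around and the vertices of the complete graph are shifted by one, so that \<open>w\<close>
  carries the stone to \<open>v\<close> only at the end of the last of \<open>n\<close> rounds.\<close>

lemma handover:
  assumes w: "w \<notin> U" and dist: "distinct (w # r @ [v])"
  defines "T \<equiv> length (outer (w # r)) * Suc (length r)"
  shows "j < T \<Longrightarrow> hd (fsteps w j (w # r @ [v])) \<notin> U"
    and "fsteps w T (w # r @ [v]) = v # r @ [w]"
proof -
  let ?y = "w # r @ [v]" and ?n = "length (outer (w # r))" and ?L = "Suc (length r)"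
  have out: "outer ?y = w # outer r" using w v_in_U by simp
  have n: "?n = Suc (length (outer r))" using w by simp
  \<comment> \<open>A meeting at time \<open>j\<close> would make \<open>j + 1\<close> the end of
    round \<open>q\<close> with \<open>w\<close> again in front of \<open>outer\<close>; this forces
    \<open>q\<close> to be a positive multiple of \<open>?n\<close>.\<close>
  have nomeet: "steps j ?y \<noteq> w # v # s" if "Suc j < T" for j s
  proof
    assume eq: "steps j ?y = w # v # s"
    then have "j mod ?L = length r"
      using steps_before_v(1)[of w r "[]" j] w dist by auto
    then have "Suc j mod ?L = 0" by (simp add: mod_Suc)
    then obtain q where q: "Suc j = q * ?L" by (metis mod_0_imp_dvd dvd_div_mult_self)
    have "outer (steps (Suc j) ?y) = rotate (q * length (outer (r @ [v]))) (outer ?y)"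
      using steps_period(2)[OF w, of q "r @ [v]"] q by simp
    moreover have "steps (Suc j) ?y = w # s @ [v]"
      using eq toric_step_base_v[OF w] by simp
    ultimately have "hd (rotate (q * length (outer r)) (w # outer r)) = w"
      using out w v_in_U by (metis (no_types, lifting) append.right_neutral filter.simps filter_append list.sel(1))
    then have "(w # outer r) ! (q * length (outer r) mod ?n) = (w # outer r) ! 0"
      by (subst (asm) hd_rotate_conv_nth) (auto simp: n)
    then have "q * length (outer r) mod ?n = 0"
      using dist by (subst (asm) nth_eq_iff_index_eq) (auto simp: n)
    then have "?n dvd q * length (outer r)" by auto
    \<comment> \<open>\<open>length (outer r)\<close> is \<open>?n - 1\<close>, so the sum is
      \<open>q * ?n\<close>.\<close>
    moreover have "?n dvd q * length (outer r) + q"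
      by (rule dvdI[of _ _ q]) (simp add: w)
    ultimately have "?n dvd q" using dvd_add_right_iff by blast
    moreover have "0 < q" using q by (cases q) auto
    ultimately have "?n \<le> q" by (simp add: dvd_imp_le)
    then have "T \<le> Suc j" unfolding T_def q by (simp only: mult_le_mono1)
    then show False using that by simp
  qed
  have eq: "fsteps w j ?y = steps j ?y" if "j < T" for j
    by (rule fsteps_eq_steps[OF w nomeet]) (use that in simp)
  show "hd (fsteps w j ?y) \<notin> U" if "j < T"
    using eq[OF that] steps_outer_head[OF w] by (metis list.sel(1))
  have "0 < T" using w by (simp add: T_def)
  then obtain t where t: "T = Suc t" by (cases T) auto
  have "steps T ?y = ?y"
  proof (rule word_eqI)
    show "map pat (steps T ?y) = map pat ?y"
      using steps_period(1)[OF w, of ?n "r @ [v]"] by (simp add: T_def)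
    show "outer (steps T ?y) = outer ?y"
    proof -
      have "length (outer ?y) = ?n" using out n by simp
      then have "rotate (?n * m) (outer ?y) = outer ?y" for m
        by (intro rotate_id) simp
      then show ?thesis using steps_period(2)[OF w, of ?n "r @ [v]"] by (simp add: T_def del: filter.simps)
    qed
  qed
  have "t mod ?L = length r"
  proof -
    have "Suc t mod ?L = 0" unfolding t[symmetric] T_def by (rule mod_mult_self2_is_0)
    then show ?thesis by (simp add: mod_Suc split: if_splits)
  qed
  then obtain k s where ks: "steps t ?y = k # v # s"
    using steps_before_v(1)[of w r "[]" t] w dist by auto
  then have "k \<notin> U" using steps_outer_head[OF w] by (metis list.sel(1))
  \<comment> \<open>Without the bridge the last step restores \<open>?y\<close>, so the stone is on
    \<open>w\<close> just before it; with the bridge that step hands the stone to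
    \<open>v\<close>.\<close>
  then have "k # s @ [v] = ?y"
    using \<open>steps T ?y = ?y\<close> ks toric_step_base_v by (simp add: t)
  then have "steps t ?y = w # v # r" using ks by simp
  then show "fsteps w T ?y = v # r @ [w]"
    using eq[of t] toric_step_full_v by (simp add: t)
qed

text \<open>Without the bridge, the stone reaches \<open>v\<close> once per round, each time one
  place further back in the cyclic order of the complete graph, so at some time on \<open>w\<close>.
  Before the first such time the bridge has no effect, and the pattern at every arrival is the
  same.\<close>

lemma leave_outer:
  assumes "k \<notin> U" "distinct (k # r1 @ v # r2)" "w \<notin> U" "w \<in> set (k # r1 @ v # r2)"
  obtains j s where "fsteps w j (k # r1 @ v # r2) = v # s @ [w]"
    "map pat s = map pat (r2 @ r1)"
proof -
  let ?r = "r1 @ v # r2"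
  let ?x = "k # ?r"
  have dist: "distinct ?r" using assms by simp
  have "\<exists>j s. steps j ?x = w # v # s"
  proof -
    obtain k0 s0 where z: "steps (length r1) ?x = k0 # v # s0"
      using steps_before_v(1)[OF assms(1) dist, of "length r1"] by auto
    have k0: "k0 \<notin> U" using steps_outer_head[OF assms(1)] z by (metis list.sel(1))
    let ?y = "k0 # s0 @ [v]"
    have y: "steps (Suc (length r1)) ?x = ?y" using z toric_step_base_v[OF k0] by simp
    have len: "length (s0 @ [v]) = length ?r"
      using y length_toric_steps[where R = base] by (metis length_Cons nat.inject)
    have "w \<in> set (outer ?y)"
      using assms(3,4) set_toric_steps[of "Suc (length r1)" base ?x] v_in_U unfolding y by auto
    then obtain i where i: "i < length (outer ?y)" "outer ?y ! i = w"
      by (auto simp: in_set_conv_nth)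
    define m where "m = length (outer (s0 @ [v]))"
    have m: "length (outer ?y) = Suc m" using k0 by (simp add: m_def)
    \<comment> \<open>Modulo \<open>Suc m\<close>, \<open>m\<close> is -1, so \<open>i * m\<close>
      rounds rotate \<open>outer\<close> by \<open>i * m * m\<close>, which is \<open>i\<close>, and
      bring \<open>w\<close> to the front.\<close>
    define q where "q = i * m"
    have "hd (outer (steps (q * length ?r) ?y)) = outer ?y ! (q * m mod Suc m)"
    proof -
      have "outer (steps (q * length ?r) ?y) = rotate (q * m) (outer ?y)"
        using steps_period(2)[OF k0, of q "s0 @ [v]"] len by (simp only: m_def)
      moreover have "outer ?y \<noteq> []" using k0 by simp
      ultimately show ?thesis using hd_rotate_conv_nth m by metis
    qed
    also have "q * m mod Suc m = i"
    proof -
      have "q * m + 2 * i * Suc m = i * Suc m * Suc m + i"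
        by (simp add: q_def algebra_simps)
      then have "q * m mod Suc m = i mod Suc m"
        by (metis mod_mult_self1 mod_mult_self3)
      then show ?thesis using i m by simp
    qed
    finally have hd_w: "hd (outer (steps (q * length ?r) ?y)) = w" using i by simp
    \<comment> \<open>One step before these rounds end \<open>v\<close> is about to be passed.
      Passing it leaves the stone where it is, so the stone is on \<open>w\<close> already.\<close>
    let ?j = "length r1 + q * length ?r"
    have "?j mod length ?r = length r1"
      by (subst mod_mult_self1) (rule mod_less, simp)
    then obtain k1 s1 where k1: "steps ?j ?x = k1 # v # s1"
      using steps_before_v(1)[OF assms(1) dist, of ?j] by auto
    have k1U: "k1 \<notin> U" using steps_outer_head[OF assms(1)] k1 by (metis list.sel(1))
    have "steps (q * length ?r) ?y = steps (Suc ?j) ?x"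
      unfolding y[symmetric] by (simp only: funpow_add[THEN fun_cong, unfolded comp_apply, symmetric]) (simp add: add.commute)
    also have "\<dots> = k1 # s1 @ [v]" using k1 toric_step_base_v[OF k1U] by simp
    finally have "k1 = w" using hd_w k1U by simp
    then show ?thesis using k1 by blast
  qed
  then obtain j where j: "\<exists>s. steps j ?x = w # v # s"
      and least: "\<And>i. i < j \<Longrightarrow> \<nexists>s. steps i ?x = w # v # s"
    using exists_least_iff[of "\<lambda>j. \<exists>s. steps j ?x = w # v # s"] by blast
  from j obtain s where s: "steps j ?x = w # v # s" by blast
  have "fsteps w j ?x = steps j ?x"
    by (rule fsteps_eq_steps[OF assms(1)]) (use least in blast)
  then have "fsteps w (Suc j) ?x = v # s @ [w]"
    using s toric_step_full_v by simp
  then show ?thesis using that steps_before_v(2)[OF assms(1) dist s] by blast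
qed

subsection \<open>The stone on \<open>S\<close>\<close>

text \<open>Cuts the cyclic word at \<open>v\<close> instead of at the stone, so that
  \<open>outer (from_v xs)\<close> lists the complete graph in the order in which \<open>v\<close>
  passes it.\<close>

definition from_v :: "'a list \<Rightarrow> 'a list" where
  "from_v xs = dropWhile (\<lambda>a. a \<noteq> v) xs @ takeWhile (\<lambda>a. a \<noteq> v) xs"

text \<open>Marks \<open>v\<close> passing some vertex of the complete graph without the bridge;
  unlike \<open>meet\<close>, it does not see which one.\<close>

fun cross :: "'a option list \<Rightarrow> nat" where
  "cross (Some a # None # _) = of_bool (a = v)"
| "cross _ = 0"

fun meet :: "'a \<Rightarrow> 'a list \<Rightarrow> nat" where
  "meet w (a # b # _) = of_bool (a = v \<and> b = w)"
| "meet w _ = 0"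

definition crosses :: "'a option list \<Rightarrow> nat \<Rightarrow> nat" where
  "crosses P k = (\<Sum>j<k. cross (psteps j P))"

definition meets :: "'a \<Rightarrow> 'a list \<Rightarrow> nat \<Rightarrow> nat" where
  "meets w xs k = (\<Sum>j<k. meet w (steps j xs))"

text \<open>How many complete-graph vertices \<open>v\<close> passes before it reaches
  \<open>w\<close>.\<close>

definition gap :: "'a \<Rightarrow> 'a list \<Rightarrow> nat" where
  "gap w xs = length (takeWhile (\<lambda>a. a \<noteq> w) (outer (from_v xs)))"

definition stone_in_U :: "'a \<Rightarrow> 'a list \<Rightarrow> bool" where
  "stone_in_U w xs \<longleftrightarrow> distinct xs \<and> v \<in> set xs \<and> w \<in> set xs \<and> w \<notin> U \<and> hd xs \<in> U"

lemma from_v_append: "v \<notin> set xs \<Longrightarrow> from_v (xs @ v # ys) = v # ys @ xs"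
proof -
  assume "v \<notin> set xs"
  then have "\<And>x. x \<in> set xs \<Longrightarrow> x \<noteq> v" by auto
  then show ?thesis by (simp add: from_v_def dropWhile_append2 takeWhile_append2)
qed

lemma stone_in_U_cases:
  assumes "stone_in_U w xs"
  obtains a b r where "xs = a # b # r" "a \<in> U" "a \<noteq> b" "distinct r" "a \<notin> set r" "b \<notin> set r"
  using assms by (cases xs rule: toric_step_cases)
      (auto simp: stone_in_U_def less_2_cases_iff length_Suc_conv)

lemma stone_in_U_step:
  assumes "stone_in_U w xs"
  shows "stone_in_U w (toric_step base xs)"
proof -
  have "hd (toric_step base xs) \<in> U"
    by (rule stone_in_U_cases[OF assms]) (auto simp: base_def)
  then show ?thesis
    using assms distinct_toric_steps[of 1 base xs] set_toric_steps[of 1 base xs]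
    by (simp add: stone_in_U_def)
qed

text \<open>The cyclic order changes only where the stone, which is on \<open>U\<close>, passes its
  neighbour. Seen from \<open>v\<close>, this affects the complete graph only if the stone is on
  \<open>v\<close> and passes one of its vertices, which goes to the back.\<close>

lemma outer_from_v_step:
  assumes "stone_in_U w xs"
  shows "outer (from_v (toric_step base xs)) = rotate (cross (map pat xs)) (outer (from_v xs))"
proof (rule stone_in_U_cases[OF assms])
  fix a b r
  assume xs: "xs = a # b # r" and a: "a \<in> U" "a \<noteq> b" "distinct r" "a \<notin> set r" "b \<notin> set r"
  have v_first: "from_v (v # zs) = v # zs" for zs
    using from_v_append[of "[]" zs] by simp
  consider "a = v" | "b = v" | "a \<noteq> v" "b \<noteq> v" "v \<in> set r"
    using assms xs by (auto simp: stone_in_U_def)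
  then show ?thesis
  proof cases
    case 1
    have last: "from_v (b # r @ [v]) = v # b # r"
      using 1 a from_v_append[of "b # r" "[]"] by auto
    show ?thesis
      unfolding xs 1 using last v_in_U by (auto simp: v_first base_def pat_def)
  next
    case 2
    have "from_v (a # v # r) = v # r @ [a]" "from_v (a # r @ [v]) = v # a # r"
      using 2 a from_v_append[of "[a]" r] from_v_append[of "a # r" "[]"] by auto
    then show ?thesis unfolding xs 2 using v_in_U a by (auto simp: v_first pat_def)
  next
    case 3
    then obtain r1 r2 where r: "r = r1 @ v # r2" by (meson split_list)
    then have "v \<notin> set r1" using a by auto
    then have "from_v (a # b # r) = v # r2 @ a # b # r1"
        "from_v (a # r @ [b]) = v # r2 @ b # a # r1"
        "from_v (b # r @ [a]) = v # r2 @ a # b # r1"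
      using 3 from_v_append[of "a # b # r1" r2] from_v_append[of "a # r1" "r2 @ [b]"]
        from_v_append[of "b # r1" "r2 @ [a]"] by (auto simp: r)
    then show ?thesis unfolding xs using 3 a by (auto simp: pat_def)
  qed
qed

lemma set_from_v [simp]: "set (from_v xs) = set xs"
  and distinct_from_v [simp]: "distinct (from_v xs) = distinct xs"
  and mset_from_v [simp]: "mset (from_v xs) = mset xs"
proof -
  show m: "mset (from_v xs) = mset xs"
    unfolding from_v_def by (metis mset_append add.commute takeWhile_dropWhile_id)
  show "set (from_v xs) = set xs" by (metis m set_mset_mset)
  show "distinct (from_v xs) = distinct xs" by (metis m mset_eq_imp_distinct_iff)
qed

text \<open>Only \<open>v\<close> with the stone changes the cyclic order of \<open>v\<close> and the vertices of the complete
  graph, and it passes the latter in their cyclic order. So over a period it passes each of them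
  equally often.\<close>

lemma meet_cross_step:
  assumes "stone_in_U w xs"
  shows "length (outer xs) * meet w xs + gap w xs = cross (map pat xs) + gap w (toric_step base xs)"
proof (rule stone_in_U_cases[OF assms])
  fix a b r
  assume xs: "xs = a # b # r" and a: "a \<in> U"
  have len: "length (outer (from_v xs)) = length (outer xs)"
    by (metis mset_filter mset_from_v size_mset)
  show ?thesis
  proof (cases "a = v \<and> b \<notin> U")
    case True
    then have "from_v xs = v # b # r"
      unfolding xs using from_v_append[of "[]" "b # r"] by simp
    then have "outer (from_v xs) = b # outer r" using True a by simp
    moreover have "length (outer (from_v xs)) * of_bool (hd (outer (from_v xs)) = w) + gap w xs
       = Suc (length (takeWhile (\<lambda>a. a \<noteq> w) (rotate1 (outer (from_v xs)))))"
      unfolding gap_def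
      using assms by (intro length_takeWhile_rotate1) (auto simp: stone_in_U_def)
    moreover have "rotate1 (outer (from_v xs)) = outer (from_v (toric_step base xs))"
      using True a outer_from_v_step[OF assms] by (simp add: xs pat_def)
    ultimately show ?thesis
      using True a len by (simp add: xs gap_def pat_def)
  next
    case False
    then have "cross (map pat xs) = 0" using a by (auto simp: xs pat_def)
    moreover have "meet w xs = 0" using False assms by (auto simp: xs stone_in_U_def)
    ultimately show ?thesis using outer_from_v_step[OF assms] by (simp add: gap_def)
  qed
qed

section \<open>Excursions over the bridge and return times\<close>

lemma stone_in_U_steps: "stone_in_U w xs \<Longrightarrow> stone_in_U w (steps k xs)"
  by (induction k) (auto simp: stone_in_U_step)

text \<open>The one-step identity telescopes. When the word recurs the gaps cancel, and
  \<open>meets\<close> is \<open>crosses\<close> divided by the size of the complete graph, whatever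
  \<open>w\<close> is.\<close>

lemma meets_crosses:
  assumes "stone_in_U w xs"
  shows "length (outer xs) * meets w xs k + gap w xs = crosses (map pat xs) k + gap w (steps k xs)"
proof (induction k)
  case (Suc k)
  have "length (outer xs) * meet w (steps k xs) + gap w (steps k xs)
          = cross (map pat (steps k xs)) + gap w (steps (Suc k) xs)"
    using meet_cross_step[OF stone_in_U_steps[OF assms], of k] by (simp add: outer_steps)
  then show ?case
    using Suc by (simp add: meets_def crosses_def algebra_simps flip: map_pat_steps)
qed (simp add: meets_def crosses_def)

text \<open>A meeting costs one step to give the stone to \<open>w\<close> and then the time of
  \<open>handover\<close>; the result is what the bridgeless step gives at once.\<close>

lemma meet_cases:
  assumes "stone_in_U w xs"
  obtains (meet) r where "xs = v # w # r" "meet w xs = 1"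
      "\<And>j. 0 < j \<Longrightarrow> j < Suc (length (outer xs) * (length xs - 1)) \<Longrightarrow> hd (fsteps w j xs) \<notin> U"
      "fsteps w (Suc (length (outer xs) * (length xs - 1))) xs = toric_step base xs"
  | (no_meet) "meet w xs = 0" "toric_step (full w) xs = toric_step base xs"
proof (rule stone_in_U_cases[OF assms])
  fix a b r
  assume xs: "xs = a # b # r" and a: "a \<in> U" "a \<noteq> b"
  have w: "w \<notin> U" "distinct xs" using assms by (auto simp: stone_in_U_def)
  show thesis
  proof (cases "a = v \<and> b = w")
    case True
    then have xs': "xs = v # w # r" using xs by simp
    have T: "length (outer xs) * (length xs - 1) = length (outer (w # r)) * Suc (length r)"
      using v_in_U by (simp add: xs')
    have first: "toric_step (full w) xs = w # r @ [v]"
      by (simp add: xs' full_def)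
    have suc: "fsteps w (Suc j) xs = fsteps w j (w # r @ [v])" for j
      by (simp add: funpow_swap1 first)
    have dist: "distinct (w # r @ [v])" using w xs' by auto
    have base: "toric_step base xs = v # r @ [w]"
      using v_in_U w by (simp add: xs' base_def)
    show thesis
    proof (rule meet[OF xs'])
      fix j assume "0 < j" "j < Suc (length (outer xs) * (length xs - 1))"
      then obtain i where "j = Suc i" "i < length (outer (w # r)) * Suc (length r)"
        unfolding T by (cases j) auto
      then show "hd (fsteps w j xs) \<notin> U"
        using handover(1)[OF w(1) dist] suc by metis
    next
      show "fsteps w (Suc (length (outer xs) * (length xs - 1))) xs = toric_step base xs"
        unfolding T suc handover(2)[OF w(1) dist] base ..
    qed (simp add: xs')
  next
    case False
    then have "{a, b} \<noteq> {v, w}" using a w by (auto simp: doubleton_eq_iff)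
    then show thesis using no_meet False by (auto simp: xs full_def)
  qed
qed

text \<open>Converts time without the bridge into time with it: each meeting adds one
  excursion.\<close>

lemma fsteps_return:
  assumes "stone_in_U w xs"
  shows "fsteps w (k + length (outer xs) * (length xs - 1) * meets w xs k) xs = steps k xs"
proof (induction k)
  case (Suc k)
  let ?c = "length (outer xs) * (length xs - 1)" and ?z = "steps k xs"
  let ?d = "Suc (?c * meet w ?z)"
  have "fsteps w ?d ?z = toric_step base ?z"
    using stone_in_U_steps[OF assms, of k]
  proof (cases rule: meet_cases)
    case (meet r)
    have "length (outer ?z) = length (outer xs)" by (simp add: outer_steps)
    then show ?thesis using meet(4) by (simp only: meet(2) length_toric_steps mult_1_right)
  qed simp
  moreover have "Suc k + ?c * meets w xs (Suc k) = ?d + (k + ?c * meets w xs k)"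
    by (simp add: meets_def algebra_simps)
  ultimately show ?case using Suc by (simp only: funpow_add comp_apply) simp
qed (simp add: meets_def)

text \<open>Converse of \<open>fsteps_return\<close>: a time with the stone on \<open>U\<close> is
  not inside an excursion, so removing the first bridgeless step, with its excursion if any, leaves
  a smaller such time.\<close>

lemma fsteps_stone_in_U:
  assumes "stone_in_U w xs" "hd (fsteps w t xs) \<in> U"
  shows "\<exists>k. t = k + length (outer xs) * (length xs - 1) * meets w xs k"
  using assms
proof (induction t arbitrary: xs rule: less_induct)
  case (less t)
  show ?case
  proof (cases "t = 0")
    case True
    then show ?thesis by (intro exI[of _ 0]) (simp add: meets_def)
  next
    case False
    let ?c = "length (outer xs) * (length xs - 1)" and ?z = "toric_step base xs"
    let ?d = "Suc (?c * meet w xs)"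
    have d: "?d \<le> t \<and> fsteps w ?d xs = ?z"
      using less.prems(1)
    proof (cases rule: meet_cases)
      case (meet r)
      have "\<not> t < Suc ?c" using meet(3)[of t] False less.prems(2) by auto
      then show ?thesis using meet by (simp del: funpow.simps)
    next
      case no_meet
      then show ?thesis using False by simp
    qed
    then have "fsteps w (t - ?d) ?z = fsteps w t xs"
      using funpow_add[of "t - ?d" ?d "toric_step (full w)"] by (simp del: funpow.simps)
    then obtain k where k: "t - ?d = k + length (outer ?z) * (length ?z - 1) * meets w ?z k"
      using less.IH[of "t - ?d" ?z] False stone_in_U_step less.prems by auto
    have "length (outer ?z) = length (outer xs)"
      using outer_steps[of 1 xs] by simp
    then have "t - ?d = k + ?c * meets w ?z k" using k by (simp only: length_toric_step)
    moreover have "meets w xs (Suc k) = meet w xs + meets w ?z k"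
      unfolding meets_def sum.lessThan_Suc_shift by (simp add: funpow_swap1)
    then have "?c * meets w xs (Suc k) = ?c * meet w xs + ?c * meets w ?z k"
      by (simp only: distrib_left)
    ultimately have "t = Suc k + ?c * meets w xs (Suc k)"
      using d by linarith
    then show ?thesis by blast
  qed
qed

text \<open>At a recurrence the size of the complete graph cancels between the excursion length and
  the number of meetings, so that only the pattern enters.\<close>

lemma return_times_stone_in_U:
  assumes "stone_in_U w xs"
  defines "P \<equiv> map pat xs"
  shows "return_times (full w) xs =
    {t. \<exists>k>0. t = k + (length P - 1) * crosses P k \<and> length P dvd t \<and>
           psteps k P = P \<and> count_list P None dvd turns P k}"
proof -
  have out: "outer xs \<noteq> []" and dist: "distinct xs" and hd: "hd xs \<in> U"
    using assms by (auto simp: stone_in_U_def filter_empty_conv)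
  note ret = steps_return_iff[OF dist out, folded P_def]
  have len: "length P = length xs" by (simp add: P_def)
  have m: "length (outer xs) * (length xs - 1) * meets w xs k = (length P - 1) * crosses P k"
    if "steps k xs = xs" for k
    using meets_crosses[OF assms(1), of k] that by (simp add: len P_def mult_ac)
  have "(0 < t \<and> fsteps w t xs = xs) \<longleftrightarrow>
        (\<exists>k>0. t = k + (length P - 1) * crosses P k \<and> steps k xs = xs)" for t
  proof
    assume t: "0 < t \<and> fsteps w t xs = xs"
    then obtain k where k: "t = k + length (outer xs) * (length xs - 1) * meets w xs k"
      using fsteps_stone_in_U[OF assms(1), of t] hd by auto
    then have "steps k xs = xs" using fsteps_return[OF assms(1), of k] t by simp
    moreover have "0 < k" using k t by (cases k) (auto simp: meets_def)
    ultimately show "\<exists>k>0. t = k + (length P - 1) * crosses P k \<and> steps k xs = xs"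
      using k m by auto
  next
    assume "\<exists>k>0. t = k + (length P - 1) * crosses P k \<and> steps k xs = xs"
    then show "0 < t \<and> fsteps w t xs = xs"
      using fsteps_return[OF assms(1)] m by (metis add_gr_0)
  qed
  then show ?thesis unfolding return_times_def len[symmetric] using ret by blast
qed

lemma return_times_outer:
  assumes "k \<notin> U" "distinct (k # r1 @ v # r2)" "w \<notin> U" "w \<in> set (k # r1 @ v # r2)"
  obtains s where "stone_in_U w (v # s @ [w])" "map pat s = map pat (r2 @ r1)"
    "return_times (full w) (k # r1 @ v # r2) = return_times (full w) (v # s @ [w])"
proof -
  obtain j s where j: "fsteps w j (k # r1 @ v # r2) = v # s @ [w]"
    and s: "map pat s = map pat (r2 @ r1)"
    using leave_outer[OF assms] by blast
  have "distinct (v # s @ [w])"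
    using assms(2) by (simp only: j[symmetric] distinct_toric_steps)
  then have "stone_in_U w (v # s @ [w])"
    using assms(3) v_in_U by (simp add: stone_in_U_def)
  moreover have "return_times (full w) (k # r1 @ v # r2) = return_times (full w) (v # s @ [w])"
    using return_times_step[of "full w" j "k # r1 @ v # r2"] full_sym by (simp add: j)
  ultimately show thesis using that s by blast
qed

text \<open>If the stone starts on \<open>U\<close>, the formula in the pattern decides. Otherwise
  both words are followed until the stone crosses to \<open>v\<close>: the times may differ, but
  return times are constant along an orbit and the patterns reached agree.\<close>

lemma return_times_cong:
  assumes "map pat xs = map pat ys"
    and "distinct xs" "v \<in> set xs" "w \<in> set xs" "w \<notin> U"
    and "distinct ys" "v \<in> set ys" "w' \<in> set ys" "w' \<notin> U"
  shows "return_times (full w) xs = return_times (full w') ys"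
proof (cases "hd xs \<in> U")
  case True
  have "xs \<noteq> []" "ys \<noteq> []" using assms(3,7) by auto
  then have "pat (hd xs) = pat (hd ys)" using assms(1) by (metis list.map_sel(1))
  then have "hd ys \<in> U" using True by (metis pat_eq_None(1))
  then show ?thesis
    using return_times_stone_in_U[of w xs] return_times_stone_in_U[of w' ys] True assms
    by (simp add: stone_in_U_def)
next
  case False
  obtain k r where "xs = k # r" "k \<notin> U" using False assms(3) by (cases xs) auto
  moreover then obtain r1 r2 where "r = r1 @ v # r2"
    using assms(3) v_in_U by (auto simp: in_set_conv_decomp)
  ultimately have xs: "xs = k # r1 @ v # r2" "k \<notin> U" by auto
  have "map pat ys = None # map pat r1 @ Some v # map pat r2"
    using assms(1) xs v_in_U by (simp add: pat_def)
  then obtain k' t where t: "ys = k' # t" "pat k' = None"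
      "map pat t = map pat r1 @ Some v # map pat r2"
    by (auto simp only: map_eq_Cons_conv)
  from t(3) obtain s1 t' where t': "t = s1 @ t'" "map pat s1 = map pat r1"
      "map pat t' = Some v # map pat r2"
    unfolding map_eq_append_conv by metis
  from t'(3) obtain b s2 where "t' = b # s2" "pat b = Some v" "map pat s2 = map pat r2"
    unfolding map_eq_Cons_conv by metis
  with t t' have ys: "ys = k' # s1 @ v # s2" "k' \<notin> U"
      "map pat s1 = map pat r1" "map pat s2 = map pat r2" by auto
  obtain s where s: "stone_in_U w (v # s @ [w])" "map pat s = map pat (r2 @ r1)"
    "return_times (full w) xs = return_times (full w) (v # s @ [w])"
    using return_times_outer[of k r1 r2 w] xs assms by metis
  obtain s' where s': "stone_in_U w' (v # s' @ [w'])" "map pat s' = map pat (s2 @ s1)"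
    "return_times (full w') ys = return_times (full w') (v # s' @ [w'])"
    using return_times_outer[of k' s1 s2 w'] ys assms by metis
  have "map pat (v # s @ [w]) = map pat (v # s' @ [w'])"
    using s(2) s'(2) ys assms(5,9) by (simp add: pat_def)
  then show ?thesis
    using return_times_stone_in_U[OF s(1)] return_times_stone_in_U[OF s'(1)] s(3) s'(3) by simp
qed

end

subsection \<open>From states to words\<close>

definition cyclic_labels :: "nat \<Rightarrow> nat \<Rightarrow> nat list" where
  "cyclic_labels N i = rotate (i - 1) [1..<Suc N]"

definition state_word :: "'a graph \<Rightarrow> ('a \<Rightarrow> nat) \<times> nat \<Rightarrow> 'a list" where
  "state_word G s = map (inv_into (verts G) (fst s)) (cyclic_labels (card (verts G)) (snd s))"

lemma set_cyclic_labels [simp]: "set (cyclic_labels N i) = {1..N}"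
  by (auto simp: cyclic_labels_def)

lemma distinct_cyclic_labels [simp]: "distinct (cyclic_labels N i)"
  by (simp add: cyclic_labels_def)

lemma length_cyclic_labels [simp]: "length (cyclic_labels N i) = N"
  by (simp add: cyclic_labels_def)

lemma cyclic_labels_next:
  assumes "i \<in> {1..N}"
  shows "cyclic_labels N (i mod N + 1) = rotate1 (cyclic_labels N i)"
proof -
  have "rotate (i mod N) [1..<Suc N] = rotate i [1..<Suc N]"
    using rotate_conv_mod[of i "[1..<Suc N]"] by simp
  also have "\<dots> = rotate1 (rotate (i - 1) [1..<Suc N])"
    using assms by (simp flip: rotate_Suc del: upt_Suc)
  finally show ?thesis by (simp add: cyclic_labels_def del: upt_Suc)
qed

lemma hd_cyclic_labels:
  assumes "i \<in> {1..N}"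
  shows "hd (cyclic_labels N i) = i"
proof -
  have "hd (cyclic_labels N i) = [1..<Suc N] ! ((i - 1) mod N)"
    using assms unfolding cyclic_labels_def by (subst hd_rotate_conv_nth) auto
  also have "(i - 1) mod N = i - 1" using assms by auto
  also have "[1..<Suc N] ! (i - 1) = i"
    using assms by (subst nth_upt) auto
  finally show ?thesis .
qed

lemma cyclic_labels_cases:
  assumes "i \<in> {1..N}" "2 \<le> N"
  obtains r where "cyclic_labels N i = i # (i mod N + 1) # r"
    "cyclic_labels N (i mod N + 1) = (i mod N + 1) # r @ [i]"
proof -
  have "\<not> length (cyclic_labels N i) < 2" using assms by simp
  then obtain a b r where *: "cyclic_labels N i = a # b # r"
    by (metis toric_step_cases)
  have "i mod N + 1 \<in> {1..N}" using assms by (auto simp: Suc_le_eq)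
  then have "hd (rotate1 (cyclic_labels N i)) = i mod N + 1"
    using hd_cyclic_labels cyclic_labels_next[OF assms(1)] by metis
  then have "b = i mod N + 1" using * by simp
  moreover have "a = i" using hd_cyclic_labels[OF assms(1)] * by simp
  ultimately show thesis
    using that * cyclic_labels_next[OF assms(1)] by simp
qed

lemma next_label_in_labels: "i \<in> labels G \<Longrightarrow> next_label G i \<in> labels G"
  by (auto simp: labels_def next_label_def Suc_le_eq)

lemma transpose_in: "i \<in> A \<Longrightarrow> j \<in> A \<Longrightarrow> l \<in> A \<Longrightarrow> transpose i j l \<in> A"
  by (auto simp: transpose_def)

lemma compose_transpose_labelings:
  assumes "\<sigma> \<in> labelings G" "i \<in> labels G" "j \<in> labels G"
  shows "compose (verts G) (transpose i j) \<sigma> \<in> labelings G"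
proof -
  have "bij_betw (transpose i j) (labels G) (labels G)"
    using assms(2,3) by (intro permutes_imp_bij permutes_swap_id)
  then have "bij_betw (transpose i j \<circ> \<sigma>) (verts G) (labels G)"
    using assms(1) by (auto simp: labelings_def intro: bij_betw_trans)
  then have "bij_betw (compose (verts G) (transpose i j) \<sigma>) (verts G) (labels G)"
    by (subst bij_betw_cong[where g = "transpose i j \<circ> \<sigma>"]) (auto simp: compose_def)
  then show ?thesis by (simp add: labelings_def)
qed

lemma inv_into_compose_transpose:
  assumes "\<sigma> \<in> labelings G" "i \<in> labels G" "j \<in> labels G" "l \<in> labels G"
  shows "inv_into (verts G) (compose (verts G) (transpose i j) \<sigma>) l
           = inv_into (verts G) \<sigma> (transpose i j l)"
proof (rule inv_into_f_eq)
  have bij: "bij_betw \<sigma> (verts G) (labels G)" using assms by (simp add: labelings_def)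
  have l: "transpose i j l \<in> labels G" using assms transpose_in by metis
  show "inj_on (compose (verts G) (transpose i j) \<sigma>) (verts G)"
    using compose_transpose_labelings[OF assms(1-3)] by (auto simp: labelings_def bij_betw_def)
  show "inv_into (verts G) \<sigma> (transpose i j l) \<in> verts G"
    using bij l by (metis bij_betw_def inv_into_into)
  then show "compose (verts G) (transpose i j) \<sigma> (inv_into (verts G) \<sigma> (transpose i j l)) = l"
    using bij_betw_inv_into_right[OF bij l] by (simp add: compose_def)
qed

lemma tpro_states: "s \<in> states G \<Longrightarrow> tpro G s \<in> states G"
  by (cases s) (auto simp: states_def intro: next_label_in_labels compose_transpose_labelings)

lemma snd_tpro: "snd (tpro G s) = next_label G (snd s)"
  by (cases s) auto

lemma length_state_word [simp]: "length (state_word G s) = card (verts G)"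
  by (simp add: state_word_def)

text \<open>On an edge the labels stay and the next vertex gets the stone; otherwise the swap gives
  the next label to the vertex with the stone, which thereby keeps it.\<close>

lemma state_word_tpro:
  assumes "s \<in> states G" "2 \<le> card (verts G)"
    and R: "\<And>a b. a \<in> verts G \<Longrightarrow> b \<in> verts G \<Longrightarrow> a \<noteq> b \<Longrightarrow> R a b \<longleftrightarrow> {a, b} \<in> edges G"
  shows "state_word G (tpro G s) = toric_step R (state_word G s)"
proof -
  obtain \<sigma> i where s: "s = (\<sigma>, i)" by (cases s)
  have \<sigma>: "\<sigma> \<in> labelings G" and i: "i \<in> labels G" using assms(1) s by (auto simp: states_def)
  have bij: "bij_betw \<sigma> (verts G) (labels G)" using \<sigma> by (simp add: labelings_def)
  let ?j = "next_label G i" and ?inv = "inv_into (verts G) \<sigma>"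
  obtain r where r: "cyclic_labels (card (verts G)) i = i # ?j # r"
      "cyclic_labels (card (verts G)) ?j = ?j # r @ [i]"
    using i assms(2) unfolding labels_def next_label_def by (rule cyclic_labels_cases)
  have j: "?j \<in> labels G" using i by (rule next_label_in_labels)
  have dist: "distinct (i # ?j # r)" and set: "set r \<subseteq> labels G"
    using r(1) distinct_cyclic_labels[of "card (verts G)" i]
      set_cyclic_labels[of "card (verts G)" i] by (auto simp: labels_def)
  have inv: "?inv l \<in> verts G" "\<sigma> (?inv l) = l" if "l \<in> labels G" for l
    using bij that by (auto simp: bij_betw_def inv_into_into f_inv_into_f)
  have ne: "?inv i \<noteq> ?inv ?j" using inv(2)[OF i] inv(2)[OF j] dist by auto
  have eq: "R (?inv i) (?inv ?j) \<longleftrightarrow> {?inv i, ?inv ?j} \<in> edges G"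
    using R[OF inv(1)[OF i] inv(1)[OF j] ne] .
  show ?thesis
  proof (cases "{?inv i, ?inv ?j} \<in> edges G")
    case True
    then show ?thesis using eq by (simp add: s state_word_def r)
  next
    case False
    let ?\<tau> = "compose (verts G) (transpose i ?j) \<sigma>"
    have "map (inv_into (verts G) ?\<tau>) r = map ?inv r"
    proof (rule map_cong[OF refl])
      fix l assume "l \<in> set r"
      then show "inv_into (verts G) ?\<tau> l = ?inv l"
        using inv_into_compose_transpose[OF \<sigma> i j, of l] set dist by (auto simp: transpose_def)
    qed
    then have "map (inv_into (verts G) ?\<tau>) (?j # r @ [i]) = ?inv i # map ?inv r @ [?inv ?j]"
      using inv_into_compose_transpose[OF \<sigma> i j] i j by simp
    then show ?thesis using False eq by (simp add: s state_word_def r)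
  qed
qed

lemma state_word_inj:
  assumes "(\<sigma>, i) \<in> states G" "(\<tau>, i) \<in> states G" "state_word G (\<sigma>, i) = state_word G (\<tau>, i)"
  shows "\<sigma> = \<tau>"
proof (rule extensionalityI)
  show "\<sigma> \<in> extensional (verts G)" "\<tau> \<in> extensional (verts G)"
    using assms by (auto simp: states_def labelings_def)
  have bij: "bij_betw \<sigma> (verts G) (labels G)" "bij_betw \<tau> (verts G) (labels G)"
    using assms by (auto simp: states_def labelings_def)
  fix x assume x: "x \<in> verts G"
  then have l: "\<sigma> x \<in> labels G" using bij by (auto simp: bij_betw_def)
  then have "inv_into (verts G) \<sigma> (\<sigma> x) = inv_into (verts G) \<tau> (\<sigma> x)"
    using assms(3) by (auto simp: state_word_def labels_def)
  then show "\<sigma> x = \<tau> x"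
    using bij_betw_inv_into_left[OF bij(1) x] bij_betw_inv_into_right[OF bij(2) l] by simp
qed

lemma snd_tpro_funpow:
  assumes "i \<in> labels G"
  shows "snd ((tpro G ^^ t) (\<sigma>, i)) = (i - 1 + t) mod card (verts G) + 1"
proof (induction t)
  case (Suc t)
  then show ?case by (simp add: snd_tpro next_label_def mod_Suc_eq)
qed (use assms in \<open>auto simp: labels_def\<close>)

text \<open>The word and the label \<open>i\<close> together determine the state, and
  \<open>i\<close> recurs exactly at the multiples of the number of vertices.\<close>

lemma orbit_length_eq_return_times:
  assumes s: "(\<sigma>, i) \<in> states G" and two: "2 \<le> card (verts G)"
    and R: "\<And>a b. a \<in> verts G \<Longrightarrow> b \<in> verts G \<Longrightarrow> a \<noteq> b \<Longrightarrow> R a b \<longleftrightarrow> {a, b} \<in> edges G"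
  shows "orbit_length G (\<sigma>, i) = (LEAST t. t \<in> return_times R (state_word G (\<sigma>, i)))"
proof -
  have i: "i \<in> labels G" using s by (simp add: states_def)
  have st: "(tpro G ^^ t) (\<sigma>, i) \<in> states G" for t
    by (induction t) (auto simp: s tpro_states)
  have word: "state_word G ((tpro G ^^ t) (\<sigma>, i)) = (toric_step R ^^ t) (state_word G (\<sigma>, i))" for t
    by (induction t) (auto simp: state_word_tpro[OF st two R])
  have idx: "snd ((tpro G ^^ t) (\<sigma>, i)) = i \<longleftrightarrow> card (verts G) dvd t" for t
  proof -
    have "(i - 1 + t) mod card (verts G) + 1 = i \<longleftrightarrow>
        (i - 1 + t) mod card (verts G) = (i - 1) mod card (verts G)"
      using i by (auto simp: labels_def)
    then show ?thesis by (simp add: snd_tpro_funpow[OF i] mod_eq_dvd_iff_nat)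
  qed
  have "(tpro G ^^ t) (\<sigma>, i) = (\<sigma>, i) \<longleftrightarrow>
      card (verts G) dvd t \<and> (toric_step R ^^ t) (state_word G (\<sigma>, i)) = state_word G (\<sigma>, i)" for t
  proof
    assume "card (verts G) dvd t \<and>
      (toric_step R ^^ t) (state_word G (\<sigma>, i)) = state_word G (\<sigma>, i)"
    moreover obtain \<tau> j where "(tpro G ^^ t) (\<sigma>, i) = (\<tau>, j)" by fastforce
    ultimately show "(tpro G ^^ t) (\<sigma>, i) = (\<sigma>, i)"
      using idx[of t] word[of t] st[of t] s state_word_inj by (metis snd_conv)
  qed (use idx word in \<open>metis snd_conv\<close>)
  then show ?thesis
    by (simp add: orbit_length_def least_power_def return_times_def conj_ac)
qed

section \<open>Comparing two bridge sums of \<open>S\<close>\<close>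

lemma (in bridge_words) map_pat_state_word_cong:
  assumes "(\<sigma>, i) \<in> states G" "(\<sigma>', i) \<in> states G'"
    and "U \<subseteq> verts G" "U \<subseteq> verts G'" "card (verts G) = card (verts G')"
    and "restrict \<sigma> U = restrict \<sigma>' U"
  shows "map pat (state_word G (\<sigma>, i)) = map pat (state_word G' (\<sigma>', i))"
proof -
  have bij: "bij_betw \<sigma> (verts G) (labels G)" "bij_betw \<sigma>' (verts G') (labels G)"
    using assms by (auto simp: states_def labelings_def labels_def)
  have eq: "\<sigma> s = \<sigma>' s" if "s \<in> U" for s using assms(6) that by (metis restrict_apply')
  have "pat (inv_into (verts G) \<sigma> l) = pat (inv_into (verts G') \<sigma>' l)" if l: "l \<in> labels G" for l
  proof -
    \<comment> \<open>As the labelings agree on \<open>U\<close>, label \<open>l\<close> sits on the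
      same vertex of \<open>U\<close> in both or is outside \<open>U\<close> in both.\<close>
    have "inv_into (verts G) \<sigma> l = a \<longleftrightarrow> inv_into (verts G') \<sigma>' l = a" if "a \<in> U" for a
      using eq[OF that] that assms(3,4) bij_betw_inv_into_left[OF bij(1), of a]
        bij_betw_inv_into_left[OF bij(2), of a] bij_betw_inv_into_right[OF bij(1) l]
        bij_betw_inv_into_right[OF bij(2) l] by auto
    then show ?thesis unfolding pat_def by metis
  qed
  then show ?thesis by (auto simp: state_word_def assms(5) labels_def)
qed

lemma bridge_sum_orbit_length:
  assumes S: "simple_graph S" "v \<in> verts S"
    and K: "complete_graph n K" "verts S \<inter> verts K = {}" "w \<in> verts K"
    and s: "(\<sigma>, i) \<in> states (bridge_sum S v K w)"
    and K': "complete_graph n K'" "verts S \<inter> verts K' = {}" "w' \<in> verts K'"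
    and s': "(\<sigma>', i) \<in> states (bridge_sum S v K' w')"
    and eq: "restrict \<sigma> (verts S) = restrict \<sigma>' (verts S)"
  shows "orbit_length (bridge_sum S v K w) (\<sigma>, i) = orbit_length (bridge_sum S v K' w') (\<sigma>', i)"
proof -
  interpret bridge_words "verts S" "edges S" v by standard (rule S)
  have card: "card (verts (bridge_sum S v K w)) = card (verts S) + n"
    if "complete_graph n K" "verts S \<inter> verts K = {}" for K :: "'a graph" and w
    using that S by (simp add: bridge_sum_def complete_graph_def simple_graph_def card_Un_disjoint)
  have two: "2 \<le> card (verts S) + n"
  proof -
    have "card (verts S) > 0" "n > 0"
      using S K by (auto simp: simple_graph_def complete_graph_def card_gt_0_iff)
    then show ?thesis by simp
  qed
  have orbit: "orbit_length (bridge_sum S v K w) (\<sigma>, i) =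
      (LEAST t. t \<in> return_times (full w) (state_word (bridge_sum S v K w) (\<sigma>, i)))"
    if K: "complete_graph n K" "verts S \<inter> verts K = {}" "w \<in> verts K"
      and s: "(\<sigma>, i) \<in> states (bridge_sum S v K w)" for K w \<sigma>
  proof (rule orbit_length_eq_return_times[OF s])
    fix a b assume "a \<in> verts (bridge_sum S v K w)" "b \<in> verts (bridge_sum S v K w)" "a \<noteq> b"
    \<comment> \<open>Edges of \<open>S\<close> stay inside \<open>S\<close> and the complete graph
      has all its pairs, so on distinct vertices \<open>base\<close> is adjacency without the
      bridge.\<close>
    then have "base a b \<longleftrightarrow> {a, b} \<in> edges S \<union> edges K"
      using K S by (auto simp: base_def bridge_sum_def complete_graph_def simple_graph_def)
    then show "full w a b \<longleftrightarrow> {a, b} \<in> edges (bridge_sum S v K w)"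
      by (auto simp: full_def bridge_sum_def)
  qed (simp add: card K two)
  have word: "distinct (state_word G (\<sigma>, i))" "set (state_word G (\<sigma>, i)) = verts G"
    if "(\<sigma>, i) \<in> states G" for G and \<sigma> :: "'a \<Rightarrow> nat"
  proof -
    have "bij_betw (inv_into (verts G) \<sigma>) (labels G) (verts G)"
      using that by (auto simp: states_def labelings_def intro: bij_betw_inv_into)
    then show "distinct (state_word G (\<sigma>, i))" "set (state_word G (\<sigma>, i)) = verts G"
      by (auto simp: state_word_def labels_def bij_betw_def distinct_map)
  qed
  have "return_times (full w) (state_word (bridge_sum S v K w) (\<sigma>, i)) =
        return_times (full w') (state_word (bridge_sum S v K' w') (\<sigma>', i))"
  proof (rule return_times_cong)
    show "map pat (state_word (bridge_sum S v K w) (\<sigma>, i)) =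
          map pat (state_word (bridge_sum S v K' w') (\<sigma>', i))"
      using map_pat_state_word_cong[OF s s' _ _ _ eq] card[OF K(1,2)] card[OF K'(1,2)]
      by (simp add: bridge_sum_def)
  qed (use word[OF s] word[OF s'] S K K' in \<open>auto simp: bridge_sum_def\<close>)
  then show ?thesis using orbit[OF K s] orbit[OF K' s'] by simp
qed

theorem theorem6:
  fixes S :: "'a graph" and n i :: nat and v :: 'a
  assumes "simple_graph S" and "v \<in> verts S"
  shows "\<exists>f :: ('a \<Rightarrow> nat) \<Rightarrow> nat. \<forall>K w \<sigma>.
           complete_graph n K \<longrightarrow> verts S \<inter> verts K = {} \<longrightarrow> w \<in> verts K \<longrightarrow>
           (\<sigma>, i) \<in> states (bridge_sum S v K w) \<longrightarrow>
           orbit_length (bridge_sum S v K w) (\<sigma>, i) = f (restrict \<sigma> (verts S))"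
proof -
  \<comment> \<open>The relation between a restriction and its possible orbit lengths is
    single-valued by the comparison, so \<open>THE\<close> gives the function; where no labeling
    restricts to \<open>\<phi>\<close>, its value is arbitrary.\<close>
  define P where "P \<phi> l \<longleftrightarrow> (\<exists>K w \<sigma>. complete_graph n K \<and> verts S \<inter> verts K = {} \<and> w \<in> verts K \<and>
      (\<sigma>, i) \<in> states (bridge_sum S v K w) \<and> restrict \<sigma> (verts S) = \<phi> \<and>
      orbit_length (bridge_sum S v K w) (\<sigma>, i) = l)" for \<phi> l
  have "l = l'" if "P \<phi> l" "P \<phi> l'" for \<phi> l l'
    using that bridge_sum_orbit_length[OF assms] unfolding P_def by metis
  then have "(THE l. P \<phi> l) = l" if "P \<phi> l" for \<phi> l
    using that by blast
  then show ?thesis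
    by (intro exI[of _ "\<lambda>\<phi>. THE l. P \<phi> l"]) (metis P_def)
qed

end
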